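(* Let $G=(C\cup I,E)$ be a split graph, where $C=\{u_1,\dots,u_n\}$ is a clique and $I=\{v_1,\dots,v_m\}$ is an independent set, let $\Delta_I=\max_{1\le j\le m} d_G(v_j)$, and suppose $d_G(u_i)-d_G(v_j)\le n-1$ for every edge $u_iv_j\in E(G)$. Then: (1) if $n$ is even, $$\Sigma'(G)\le\min\left\{\sum_{j=1}^{m}\frac{d_G(v_j)(d_G(v_j)+1)}{2}+\frac{(2\Delta_I+n)n(n-1)}{4},\ \Sigma'(K_n)+\sum_{j=1}^{m}\frac{d_G(v_j)(d_G(v_j)+2n-1)}{2}\right\};$$ (2) if $n$ is odd, $$\Sigma'(G)\le\min\left\{\sum_{j=1}^{m}\frac{d_G(v_j)(d_G(v_j)+1)}{2}+\frac{(2\Delta_I+n+1)n(n-1)}{4},\ \Sigma'(K_n)+\sum_{j=1}^{m}\frac{d_G(v_j)(d_G(v_j)+2n+1)}{2}\right\}.$$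
   Context: Graphs are finite, undirected, without loops or multiple edges; $d_G(v)$ is the degree of $v$ and $K_n$ the complete graph on $n$ vertices. A split graph is a graph whose vertex set can be partitioned into a clique $C$ and an independent set $I$. A proper edge-coloring is a map $\alpha:E(G)\to\mathbb{N}=\{1,2,\dots\}$ with adjacent edges receiving distinct colors; $\Sigma'(G,\alpha)=\sum_{e\in E(G)}\alpha(e)$ and the edge-chromatic sum is $\Sigma'(G)=\min_\alpha\Sigma'(G,\alpha)$ over all proper edge-colorings $\alpha$ of $G$. *)

theory Defs
  imports Complex_Main "HOL-Library.Ramsey"
begin

text \<open>
  A graph is given by a vertex set \<open>V\<close> and a set \<open>E\<close> of two-element subsets of \<open>V\<close>;
  cliques and independent sets are \<^const>\<open>clique\<close> and \<^const>\<open>indep\<close>, and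
  \<open>[V]\<^bsup>2\<^esup>\<close> (\<^const>\<open>nsets\<close>) is the edge set of the complete graph on \<open>V\<close>.
\<close>

definition fin_graph :: "'a set \<Rightarrow> 'a set set \<Rightarrow> bool" where
  "fin_graph V E \<longleftrightarrow> finite V \<and> E \<subseteq> [V]\<^bsup>2\<^esup>"

definition degree :: "'a set set \<Rightarrow> 'a \<Rightarrow> nat" where
  "degree E v = card {e \<in> E. v \<in> e}"

text \<open>The inserted \<open>0\<close> only matters for \<open>S = {}\<close>, where the maximum is taken to be \<open>0\<close>.\<close>

definition max_degree_on :: "'a set set \<Rightarrow> 'a set \<Rightarrow> nat" where
  "max_degree_on E S = Max (insert 0 (degree E ` S))"

definition split_graph :: "'a set \<Rightarrow> 'a set \<Rightarrow> 'a set set \<Rightarrow> bool" where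
  "split_graph C I E \<longleftrightarrow>
     fin_graph (C \<union> I) E \<and> C \<inter> I = {} \<and> clique C E \<and> indep I E"

text \<open>Colors are positive. A coloring is a total function; its values outside \<open>E\<close> play no role.\<close>

definition proper_edge_coloring :: "'a set set \<Rightarrow> ('a set \<Rightarrow> nat) \<Rightarrow> bool" where
  "proper_edge_coloring E \<alpha> \<longleftrightarrow>
     (\<forall>e\<in>E. 1 \<le> \<alpha> e) \<and>
     (\<forall>e\<in>E. \<forall>f\<in>E. e \<noteq> f \<and> e \<inter> f \<noteq> {} \<longrightarrow> \<alpha> e \<noteq> \<alpha> f)"

definition color_sum :: "'a set set \<Rightarrow> ('a set \<Rightarrow> nat) \<Rightarrow> nat" where
  "color_sum E \<alpha> = (\<Sum>e\<in>E. \<alpha> e)"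

definition edge_chromatic_sum :: "'a set set \<Rightarrow> nat" where
  "edge_chromatic_sum E = (LEAST s. \<exists>\<alpha>. proper_edge_coloring E \<alpha> \<and> color_sum E \<alpha> = s)"

lemma edge_chromatic_sum_attained:
  assumes "finite E"
  shows "\<exists>\<alpha>. proper_edge_coloring E \<alpha> \<and> color_sum E \<alpha> = edge_chromatic_sum E"
proof -
  obtain f :: "'a set \<Rightarrow> nat" where f: "inj_on f E"
    using finite_imp_inj_to_nat_seg[OF assms] by auto
  have "proper_edge_coloring E (\<lambda>e. Suc (f e))"
    using f by (simp add: proper_edge_coloring_def inj_on_eq_iff)
  then have "\<exists>s. \<exists>\<alpha>. proper_edge_coloring E \<alpha> \<and> color_sum E \<alpha> = s"
    by blast
  then show ?thesis
    unfolding edge_chromatic_sum_def by (rule LeastI_ex)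
qed

definition complete_graph_edges :: "nat \<Rightarrow> nat set set" where
  "complete_graph_edges n = [{1..n}]\<^bsup>2\<^esup>"

end

theory Submission
  imports Defs "HOL-Number_Theory.Cong"
begin

text \<open>
  In the bipartite graph \<open>H\<close> of clique-independent edges the hypothesis says \<open>d\<^sub>H(u) \<le> d\<^sub>H(v)\<close> for
  every edge \<open>uv\<close>. Such an \<open>H\<close> can be colored so that every \<open>v \<in> I\<close> sees exactly the colors
  \<open>1, \<dots>, d(v)\<close>: give the largest color \<open>k\<close> to a matching that covers all vertices of degree \<open>k\<close> on
  both sides and uses only edges whose end in \<open>I\<close> has degree \<open>k\<close>; removing it preserves the
  degree condition. The first bound colors \<open>H\<close> this way and shifts a round-robin coloring of the
  clique above it; the second keeps the clique coloring, which is optimal for \<open>K\<^sub>n\<close>, and shifts \<open>H\<close>.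
\<close>

section \<open>Interval colorings of bipartite graphs\<close>

text \<open>Hall's theorem, by the classical induction on \<open>A\<close>: if some nonempty proper
  subset \<open>S\<close> is tight (exactly \<open>card S\<close> neighbours), then \<open>S\<close>
  and \<open>A - S\<close> are matched separately; otherwise one element is matched
  arbitrarily.\<close>

lemma hall_marriage:
  assumes "finite A" "\<And>a. a \<in> A \<Longrightarrow> finite (N a)"
    and "\<And>S. S \<subseteq> A \<Longrightarrow> card S \<le> card (\<Union>(N ` S))"
  shows "\<exists>f. inj_on f A \<and> (\<forall>a\<in>A. f a \<in> N a)"
  using assms
proof (induction A arbitrary: N rule: finite_psubset_induct)
  case (psubset A)
  have fin: "finite (\<Union>(N ` S))" if "S \<subseteq> A" for S
  proof (rule finite_UN_I)
    show "finite S" using that psubset.hyps by (rule finite_subset)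
    show "finite (N a)" if "a \<in> S" for a
      using that \<open>S \<subseteq> A\<close> by (intro psubset.prems(1)) (rule subsetD)
  qed
  show ?case
  proof (cases "\<exists>S. S \<noteq> {} \<and> S \<subset> A \<and> card S = card (\<Union>(N ` S))")
    case True
    then obtain S where S: "S \<noteq> {}" "S \<subset> A" "card S = card (\<Union>(N ` S))" by blast
    have "\<exists>f. inj_on f S \<and> (\<forall>a\<in>S. f a \<in> N a)"
      using S(2) psubset.prems by (intro psubset.IH) auto
    then obtain f where f: "inj_on f S" "\<forall>a\<in>S. f a \<in> N a" by blast
    \<comment> \<open>Hall's condition survives on \<open>A - S\<close> after deleting the
      neighbours of \<open>S\<close>: apply it to \<open>S \<union> T\<close> and subtract
      \<open>card S\<close>, which tightness equates with the number of deleted neighbours.\<close>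
    have "\<exists>g. inj_on g (A - S) \<and> (\<forall>a\<in>A - S. g a \<in> N a - \<Union>(N ` S))"
    proof (intro psubset.IH)
      show "A - S \<subset> A" using S by blast
      show "finite (N a - \<Union>(N ` S))" if "a \<in> A - S" for a
        using that psubset.prems(1) by blast
      fix T assume T: "T \<subseteq> A - S"
      have finS: "finite S" "finite T"
        using S(2) T psubset.hyps by (auto intro: finite_subset)
      have "card S + card T = card (S \<union> T)"
        using T finS by (subst card_Un_disjoint) auto
      also have "\<dots> \<le> card (\<Union>(N ` (S \<union> T)))"
        using T S(2) by (intro psubset.prems(2)) auto
      also have "\<Union>(N ` (S \<union> T)) = \<Union>(N ` S) \<union> (\<Union>a\<in>T. N a - \<Union>(N ` S))"
        by auto
      also have "card \<dots> \<le> card (\<Union>(N ` S)) + card (\<Union>a\<in>T. N a - \<Union>(N ` S))"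
        by (rule card_Un_le)
      finally show "card T \<le> card (\<Union>a\<in>T. N a - \<Union>(N ` S))"
        using S(3) by linarith
    qed
    then obtain g where g: "inj_on g (A - S)" "\<forall>a\<in>A - S. g a \<in> N a - \<Union>(N ` S)" by blast
    let ?h = "\<lambda>a. if a \<in> S then f a else g a"
    have "inj_on ?h A"
    proof (rule inj_onI)
      fix x y assume xy: "x \<in> A" "y \<in> A" "?h x = ?h y"
      have "f z \<noteq> g z'" if "z \<in> S" "z' \<in> A - S" for z z'
        using that f(2) g(2) by auto
      then have "x \<in> S \<longleftrightarrow> y \<in> S" using xy by (metis DiffI)
      with xy f(1) g(1) show "x = y" by (auto simp: inj_on_def split: if_splits)
    qed
    moreover have "\<forall>a\<in>A. ?h a \<in> N a" using f g by auto
    ultimately show ?thesis by blast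
  next
    case False
    show ?thesis
    proof (cases "A = {}")
      case True
      then show ?thesis by simp
    next
      case nonempty: False
      then obtain a where a: "a \<in> A" by blast
      with psubset.prems(2)[of "{a}"] obtain b where b: "b \<in> N a" by fastforce
      \<comment> \<open>Every nonempty \<open>T\<close> in \<open>A - {a}\<close> is a proper subset
        of \<open>A\<close>, hence not tight, and so has a neighbour to spare when \<open>b\<close>
        is deleted.\<close>
      have "\<exists>g. inj_on g (A - {a}) \<and> (\<forall>x\<in>A - {a}. g x \<in> N x - {b})"
      proof (intro psubset.IH)
        show "A - {a} \<subset> A" using a by blast
        show "finite (N x - {b})" if "x \<in> A - {a}" for x
          using that psubset.prems(1) by blast
        fix T assume T: "T \<subseteq> A - {a}"
        show "card T \<le> card (\<Union>x\<in>T. N x - {b})"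
        proof (cases "T = {}")
          case True
          then show ?thesis by simp
        next
          case nonempty: False
          have "T \<subset> A" using T a by blast
          with False nonempty have "card T \<noteq> card (\<Union>(N ` T))" by blast
          moreover have "card T \<le> card (\<Union>(N ` T))"
            using \<open>T \<subset> A\<close> by (intro psubset.prems(2)) auto
          moreover have "card (\<Union>(N ` T)) - 1 \<le> card (\<Union>(N ` T) - {b})"
            using fin[of T] \<open>T \<subset> A\<close> by (simp add: card_Diff_singleton_if)
          ultimately have "card T \<le> card (\<Union>(N ` T) - {b})" by linarith
          also have "\<Union>(N ` T) - {b} = (\<Union>x\<in>T. N x - {b})" by blast
          finally show ?thesis .
        qed
      qed
      then obtain g where g: "inj_on g (A - {a})" "\<forall>x\<in>A - {a}. g x \<in> N x - {b}" by blast
      have "inj_on (g(a := b)) A"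
        using g by (auto simp: inj_on_def)
      moreover have "\<forall>x\<in>A. (g(a := b)) x \<in> N x" using g b by auto
      ultimately show ?thesis by blast
    qed
  qed
qed

text \<open>The integral core of Birkhoff's theorem, by double counting: the rows in
  \<open>S\<close> carry total weight \<open>k * card S\<close>, all of it in the columns of their
  support, and each of these columns carries only \<open>k\<close>. This is Hall's
  condition.\<close>

lemma regular_weights_permutation:
  fixes w :: "'a \<Rightarrow> 'a \<Rightarrow> nat"
  assumes "finite X" "k > 0"
    and row: "\<And>x. x \<in> X \<Longrightarrow> (\<Sum>y\<in>X. w x y) = k"
    and col: "\<And>y. y \<in> X \<Longrightarrow> (\<Sum>x\<in>X. w x y) = k"
  shows "\<exists>\<pi>. bij_betw \<pi> X X \<and> (\<forall>x\<in>X. w x (\<pi> x) > 0)"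
proof -
  let ?N = "\<lambda>x. {y \<in> X. w x y > 0}"
  have "\<exists>\<pi>. inj_on \<pi> X \<and> (\<forall>x\<in>X. \<pi> x \<in> ?N x)"
  proof (rule hall_marriage)
    fix S assume S: "S \<subseteq> X"
    let ?NS = "\<Union>(?N ` S)"
    have "card S * k = (\<Sum>x\<in>S. \<Sum>y\<in>X. w x y)"
      using S row by (simp add: subset_eq)
    also have "\<dots> = (\<Sum>x\<in>S. \<Sum>y\<in>?NS. w x y)"
      using \<open>finite X\<close> by (intro sum.cong refl sum.mono_neutral_right) auto
    also have "\<dots> = (\<Sum>y\<in>?NS. \<Sum>x\<in>S. w x y)" by (rule sum.swap)
    also have "\<dots> \<le> (\<Sum>y\<in>?NS. \<Sum>x\<in>X. w x y)"
      using S \<open>finite X\<close> by (intro sum_mono sum_mono2) auto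
    also have "\<dots> = (\<Sum>y\<in>?NS. k)"
      using col by (intro sum.cong) auto
    finally show "card S \<le> card ?NS" using \<open>k > 0\<close> by simp
  next
    show "finite (?N x)" for x using \<open>finite X\<close> by simp
  qed (rule \<open>finite X\<close>)
  then obtain \<pi> where \<pi>: "inj_on \<pi> X" "\<forall>x\<in>X. \<pi> x \<in> ?N x" by blast
  then have "\<pi> ` X = X"
    using \<open>finite X\<close> by (intro card_subset_eq) (auto simp: card_image)
  with \<pi> show ?thesis by (auto simp: bij_betw_def)
qed

text \<open>Putting the deficiency \<open>k - d x\<close> of every vertex on the diagonal makes the
  adjacency matrix \<open>k\<close>-regular; a vertex of full degree has diagonal entry \<open>0\<close>.\<close>

lemma symmetric_relation_permutation:
  assumes "finite X" "k > 0" "R \<subseteq> X \<times> X" "sym R" "irrefl R"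
    and deg: "\<And>x. x \<in> X \<Longrightarrow> card (R `` {x}) \<le> k"
  shows "\<exists>\<pi>. bij_betw \<pi> X X \<and>
    (\<forall>x\<in>X. (x, \<pi> x) \<in> R \<or> \<pi> x = x \<and> card (R `` {x}) < k)"
proof -
  define w where "w x y = of_bool ((x, y) \<in> R) + (if x = y then k - card (R `` {x}) else 0)" for x y
  have row: "(\<Sum>y\<in>X. w x y) = k" if "x \<in> X" for x
  proof -
    have "X \<inter> {y. (x, y) \<in> R} = R `` {x}" using assms(3) by blast
    then show ?thesis
      using that deg[OF that] assms(1) by (simp add: w_def sum.distrib)
  qed
  have "w x y = w y x" for x y
    using \<open>sym R\<close> by (auto simp: w_def dest: symD)
  then have "(\<Sum>x\<in>X. w x y) = (\<Sum>x\<in>X. w y x)" for y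
    by (intro sum.cong) auto
  with row have "(\<Sum>x\<in>X. w x y) = k" if "y \<in> X" for y
    using that by simp
  with row have "\<exists>\<pi>. bij_betw \<pi> X X \<and> (\<forall>x\<in>X. w x (\<pi> x) > 0)"
    using assms(1,2) by (intro regular_weights_permutation[where k = k])
  then obtain \<pi> where \<pi>: "bij_betw \<pi> X X" "\<And>x. x \<in> X \<Longrightarrow> w x (\<pi> x) > 0"
    by blast
  have "(x, \<pi> x) \<in> R \<or> \<pi> x = x \<and> card (R `` {x}) < k" if "x \<in> X" for x
    using \<pi>(2)[OF that] by (auto simp: w_def split: if_splits)
  with \<pi>(1) show ?thesis by blast
qed

section \<open>Matchings and interval colorings of bipartite graphs\<close>

text \<open>A permutation that moves vertices only along edges, in either direction, must move every
  vertex of degree \<open>k\<close>. Its steps from \<open>A\<close> to \<open>B\<close> form the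
  required matching.\<close>

lemma matching_covering_full_degree:
  assumes "finite A" "finite B" "A \<inter> B = {}" "H \<subseteq> A \<times> B" "k > 0"
    and degA: "\<And>a. a \<in> A \<Longrightarrow> card (H `` {a}) \<le> k"
    and degB: "\<And>b. b \<in> B \<Longrightarrow> card (H\<inverse> `` {b}) \<le> k"
  obtains M where "M \<subseteq> H" "single_valued M" "single_valued (M\<inverse>)"
    "\<And>a. a \<in> A \<Longrightarrow> card (H `` {a}) = k \<Longrightarrow> a \<in> Domain M"
    "\<And>b. b \<in> B \<Longrightarrow> card (H\<inverse> `` {b}) = k \<Longrightarrow> b \<in> Range M"
proof -
  define R X where "R = H \<union> H\<inverse>" and "X = A \<union> B"
  have RA: "R `` {a} = H `` {a}" if "a \<in> A" for a
    using that assms(3,4) by (auto simp: R_def)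
  have RB: "R `` {b} = H\<inverse> `` {b}" if "b \<in> B" for b
    using that assms(3,4) by (auto simp: R_def)
  have "\<exists>\<pi>. bij_betw \<pi> X X \<and> (\<forall>x\<in>X. (x, \<pi> x) \<in> R \<or> \<pi> x = x \<and> card (R `` {x}) < k)"
  proof (rule symmetric_relation_permutation)
    show "card (R `` {x}) \<le> k" if "x \<in> X" for x
    proof (cases "x \<in> A")
      case True
      then show ?thesis using degA by (simp add: RA)
    next
      case False
      with that have "x \<in> B" by (simp add: X_def)
      then show ?thesis using degB by (simp add: RB)
    qed
    show "finite X" using assms(1,2) by (simp add: X_def)
    show "R \<subseteq> X \<times> X" using assms(4) by (auto simp: R_def X_def)
    show "sym R" by (auto simp: R_def sym_def)
    show "irrefl R" using assms(3,4) by (auto simp: R_def irrefl_def)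
  qed (rule \<open>k > 0\<close>)
  then obtain \<pi> where bij: "bij_betw \<pi> X X"
    and \<pi>: "\<And>x. x \<in> X \<Longrightarrow> (x, \<pi> x) \<in> R \<or> \<pi> x = x \<and> card (R `` {x}) < k"
    by blast
  have inj: "inj_on \<pi> X" and surj: "\<pi> ` X = X" using bij by (simp_all add: bij_betw_def)
  \<comment> \<open>Steps from \<open>B\<close> back to \<open>A\<close> are dropped, so that no
    vertex is used twice: an \<open>a\<close> has only its image, and a \<open>b\<close> only its
    preimage because \<open>\<pi>\<close> is injective.\<close>
  define M where "M = {(a, b) \<in> H. b = \<pi> a}"
  show thesis
  proof (rule that[of M])
    show "M \<subseteq> H" by (auto simp: M_def)
    show "single_valued M" by (simp add: M_def single_valued_def)
    show "single_valued (M\<inverse>)"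
    proof (rule single_valuedI)
      fix b x y assume "(b, x) \<in> M\<inverse>" "(b, y) \<in> M\<inverse>"
      then have "x \<in> X" "y \<in> X" "\<pi> x = \<pi> y"
        using assms(4) by (auto simp: M_def X_def)
      with inj show "x = y" by (simp add: inj_on_def)
    qed
    show "a \<in> Domain M" if a: "a \<in> A" "card (H `` {a}) = k" for a
    proof -
      have "a \<in> X" using a(1) by (simp add: X_def)
      from \<pi>[OF this] a(2) RA[OF a(1)] have "(a, \<pi> a) \<in> R" by simp
      then have "(a, \<pi> a) \<in> H" using a(1) assms(3,4) by (auto simp: R_def)
      then show ?thesis by (auto simp: M_def)
    qed
    show "b \<in> Range M" if b: "b \<in> B" "card (H\<inverse> `` {b}) = k" for b
    proof -
      \<comment> \<open>For \<open>b\<close> the preimage under \<open>\<pi>\<close> matters, not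
        the image: since \<open>b\<close> has full degree it is no fixed point, so its preimage is a
        neighbour in \<open>A\<close>.\<close>
      have "b \<in> \<pi> ` X" using b(1) surj by (simp add: X_def)
      then obtain x where x: "b = \<pi> x" "x \<in> X" by (rule imageE)
      have "card (R `` {b}) = k" using b RB by simp
      with \<pi>[OF x(2)] have "(x, b) \<in> R" unfolding x(1)[symmetric] by (cases "b = x") simp_all
      then have "(x, b) \<in> H" using b(1) assms(3,4) by (auto simp: R_def)
      then show ?thesis using x(1) by (auto simp: M_def)
    qed
  qed
qed

text \<open>Induction on the degree bound \<open>k\<close>: color \<open>Suc k\<close> goes to a
  matching whose removal lowers all degrees to at most \<open>k\<close>. The ends in
  \<open>B\<close> see initial intervals of colors; for the ends in \<open>A\<close> distinct colors
  suffice.\<close>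

lemma bipartite_interval_coloring:
  assumes "finite A" "finite B" "A \<inter> B = {}" "H \<subseteq> A \<times> B"
    and "\<And>a b. (a, b) \<in> H \<Longrightarrow> card (H `` {a}) \<le> card (H\<inverse> `` {b})"
    and "\<And>b. b \<in> B \<Longrightarrow> card (H\<inverse> `` {b}) \<le> k"
  shows "\<exists>f :: 'a \<times> 'a \<Rightarrow> nat.
    (\<forall>a. inj_on (\<lambda>b. f (a, b)) (H `` {a})) \<and>
    (\<forall>b. bij_betw (\<lambda>a. f (a, b)) (H\<inverse> `` {b}) {1..card (H\<inverse> `` {b})})"
  using assms(4-)
proof (induction k arbitrary: H)
  case 0
  have "H = {}"
  proof (rule ccontr)
    assume "H \<noteq> {}"
    then obtain a b where ab: "(a, b) \<in> H" by auto
    have "finite (H\<inverse> `` {b})"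
      using 0(1) assms(1) by (auto intro: finite_subset[of _ A])
    moreover have "a \<in> H\<inverse> `` {b}" "b \<in> B" using ab 0(1) by auto
    ultimately show False using 0(3)[of b] by auto
  qed
  then show ?case by (simp add: bij_betw_def)
next
  case (Suc k)
  have finH: "finite (H `` S)" "finite (H\<inverse> `` S)" for S
    using Suc.prems(1) assms(1,2) by (auto intro: finite_subset[of _ A] finite_subset[of _ B])
  \<comment> \<open>The degree condition carries the bound from \<open>B\<close> over to
    \<open>A\<close>.\<close>
  have degA: "card (H `` {a}) \<le> Suc k" for a
  proof (cases "H `` {a} = {}")
    case False
    then obtain b where "(a, b) \<in> H" by blast
    then show ?thesis using Suc.prems(1) Suc.prems(2)[of a b] Suc.prems(3)[of b] by auto
  qed simp
  obtain N where N: "N \<subseteq> H" "single_valued N" "single_valued (N\<inverse>)"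
    and NA: "\<And>a. a \<in> A \<Longrightarrow> card (H `` {a}) = Suc k \<Longrightarrow> a \<in> Domain N"
    and NB: "\<And>b. b \<in> B \<Longrightarrow> card (H\<inverse> `` {b}) = Suc k \<Longrightarrow> b \<in> Range N"
    by (rule matching_covering_full_degree[OF assms(1-3) Suc.prems(1) zero_less_Suc degA Suc.prems(3)])
      (assumption, rule that)
  \<comment> \<open>\<open>N\<close> may also meet some \<open>b\<close> of smaller degree, where
    color \<open>Suc k\<close> would break the interval; those edges are discarded.\<close>
  define M where "M = {(a, b) \<in> N. card (H\<inverse> `` {b}) = Suc k}"
  have M: "M \<subseteq> H" "single_valued M" "single_valued (M\<inverse>)"
    using N by (auto simp: M_def single_valued_def)
  have MB: "b \<in> Range M \<longleftrightarrow> card (H\<inverse> `` {b}) = Suc k" for b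
  proof
    assume b: "card (H\<inverse> `` {b}) = Suc k"
    then have "H\<inverse> `` {b} \<noteq> {}" by auto
    then have "b \<in> B" using Suc.prems(1) by auto
    with b NB show "b \<in> Range M" by (auto simp: M_def)
  qed (auto simp: M_def)
  \<comment> \<open>Discarding edges uncovers no \<open>a\<close> of full degree: by the degree
    condition its partner in \<open>N\<close> has degree at least \<open>Suc k\<close>, hence
    exactly \<open>Suc k\<close>.\<close>
  have MA: "a \<in> Domain M" if "card (H `` {a}) = Suc k" for a
  proof -
    from that have "H `` {a} \<noteq> {}" by auto
    then have "a \<in> A" using Suc.prems(1) by auto
    then have "a \<in> Domain N" using that by (rule NA)
    then obtain b where b: "(a, b) \<in> N" by (rule DomainE)
    with N(1) have "(a, b) \<in> H" by blast
    then have "card (H\<inverse> `` {b}) = Suc k"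
      using Suc.prems(1) Suc.prems(2)[of a b] Suc.prems(3)[of b] that by auto
    with b show ?thesis by (auto simp: M_def)
  qed
  let ?H = "H - M"
  have unchanged: "?H\<inverse> `` {b} = H\<inverse> `` {b}" if "card (H\<inverse> `` {b}) \<noteq> Suc k" for b
    using that MB[of b] by auto
  have full: "\<exists>a. (a, b) \<in> M \<and> H\<inverse> `` {b} = insert a (?H\<inverse> `` {b}) \<and> a \<notin> ?H\<inverse> `` {b} \<and>
      card (?H\<inverse> `` {b}) = k"
    if "card (H\<inverse> `` {b}) = Suc k" for b
  proof -
    have "b \<in> Range M" using MB that by simp
    then obtain a where a: "(a, b) \<in> M" by (rule RangeE)
    then have "H\<inverse> `` {b} = insert a (?H\<inverse> `` {b})" "a \<notin> ?H\<inverse> `` {b}"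
      using M by (auto simp: single_valued_def)
    moreover have "card (?H\<inverse> `` {b}) = k"
    proof -
      have "?H\<inverse> `` {b} = H\<inverse> `` {b} - {a}" using calculation by blast
      then show ?thesis using that a M(1) by (auto simp: card_Diff_singleton_if)
    qed
    ultimately show ?thesis using a by blast
  qed
  have deg_le: "card (?H\<inverse> `` {b}) \<le> k" if "b \<in> B" for b
  proof (cases "card (H\<inverse> `` {b}) = Suc k")
    case True
    with full[OF True] show ?thesis by auto
  next
    case False
    with Suc.prems(3)[OF that] unchanged[OF False] show ?thesis by simp
  qed
  have mono: "card (?H `` {a}) \<le> card (H `` {a})" for a
    using finH by (intro card_mono) auto
  have deg': "card (?H `` {a}) \<le> k" for a
  proof (cases "card (H `` {a}) = Suc k")
    case True
    then have "a \<in> Domain M" by (rule MA)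
    then obtain b where "(a, b) \<in> M" by (rule DomainE)
    then have "?H `` {a} \<subset> H `` {a}" using M(1) by blast
    from psubset_card_mono[OF finH(1) this] True show ?thesis by simp
  next
    case False
    with degA[of a] mono[of a] show ?thesis by linarith
  qed
  have "\<exists>f :: 'a \<times> 'a \<Rightarrow> nat. (\<forall>a. inj_on (\<lambda>b. f (a, b)) (?H `` {a})) \<and>
    (\<forall>b. bij_betw (\<lambda>a. f (a, b)) (?H\<inverse> `` {b}) {1..card (?H\<inverse> `` {b})})"
  proof (rule Suc.IH)
    show "?H \<subseteq> A \<times> B" using Suc.prems by blast
    show "card (?H\<inverse> `` {b}) \<le> k" if "b \<in> B" for b
      using that by (rule deg_le)
    \<comment> \<open>The condition persists: a \<open>b\<close> of full degree drops to exactly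
      \<open>k\<close>, which now bounds every degree in \<open>A\<close>; any other
      \<open>b\<close> keeps its degree, while that of \<open>a\<close> cannot grow.\<close>
    show "card (?H `` {a}) \<le> card (?H\<inverse> `` {b})" if "(a, b) \<in> ?H" for a b
    proof (cases "card (H\<inverse> `` {b}) = Suc k")
      case True
      with full[OF True] deg' show ?thesis by auto
    next
      case False
      have "card (?H `` {a}) \<le> card (H\<inverse> `` {b})"
        using mono[of a] Suc.prems(2)[of a b] that by auto
      with unchanged[OF False] show ?thesis by simp
    qed
  qed
  then obtain f :: "'a \<times> 'a \<Rightarrow> nat"
    where fA: "\<And>a. inj_on (\<lambda>b. f (a, b)) (?H `` {a})"
      and fB: "\<And>b. bij_betw (\<lambda>a. f (a, b)) (?H\<inverse> `` {b}) {1..card (?H\<inverse> `` {b})}"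
    by blast
  \<comment> \<open>Thus \<open>Suc k\<close> is a new color for the matching.\<close>
  have f_le: "f (a, b) \<le> k" if "(a, b) \<in> ?H" for a b
  proof -
    have "card (?H\<inverse> `` {b}) \<le> k"
      using that Suc.prems(1) by (intro deg_le) auto
    moreover have "f (a, b) \<in> {1..card (?H\<inverse> `` {b})}"
      using that by (intro bij_betw_apply[OF fB]) auto
    ultimately show ?thesis by simp
  qed
  let ?g = "\<lambda>e. if e \<in> M then Suc k else f e"
  have "inj_on (\<lambda>b. ?g (a, b)) (H `` {a})" for a
  proof (rule inj_onI)
    fix b c assume bc: "b \<in> H `` {a}" "c \<in> H `` {a}" "?g (a, b) = ?g (a, c)"
    then have iff: "(a, b) \<in> M \<longleftrightarrow> (a, c) \<in> M"
      using f_le[of a b] f_le[of a c] by (auto split: if_splits)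
    show "b = c"
    proof (cases "(a, b) \<in> M")
      case True
      with iff M(2) show ?thesis by (auto simp: single_valued_def)
    next
      case False
      with iff bc show ?thesis using inj_onD[OF fA[of a], of b c] by auto
    qed
  qed
  moreover have "bij_betw (\<lambda>a. ?g (a, b)) (H\<inverse> `` {b}) {1..card (H\<inverse> `` {b})}" for b
  proof -
    have g: "bij_betw (\<lambda>a. ?g (a, b)) (?H\<inverse> `` {b}) {1..card (?H\<inverse> `` {b})}"
      using fB[of b] by (subst bij_betw_cong[where g = "\<lambda>a. f (a, b)"]) auto
    show ?thesis
    proof (cases "card (H\<inverse> `` {b}) = Suc k")
      case True
      then obtain a where a: "(a, b) \<in> M" "H\<inverse> `` {b} = insert a (?H\<inverse> `` {b})"
        "a \<notin> ?H\<inverse> `` {b}" "card (?H\<inverse> `` {b}) = k"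
        using full[OF True] by blast
      have "bij_betw (\<lambda>a. ?g (a, b)) (?H\<inverse> `` {b} \<union> {a}) ({1..k} \<union> {?g (a, b)})"
        using g a by (subst notIn_Un_bij_betw3[symmetric]) auto
      moreover have "{1..k} \<union> {?g (a, b)} = {1..Suc k}" using a(1) by auto
      ultimately show ?thesis using a(2) True by simp
    next
      case False
      with g unchanged[of b] show ?thesis by simp
    qed
  qed
  ultimately show ?case by (intro exI[of _ ?g] conjI allI)
qed

section \<open>Edge-chromatic sums of complete graphs\<close>

text \<open>At most \<open>h * t\<close> edges have a color up to \<open>t\<close>, so at least
  \<open>h * (N - t)\<close> edges have a larger one. The sum is least when the colors
  \<open>1\<close> to \<open>N\<close> are used \<open>h\<close> times each.\<close>

lemma color_sum_lower_bound:
  assumes "finite E" "card E = h * N" "\<And>e. e \<in> E \<Longrightarrow> 1 \<le> \<alpha> e"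
    and class_le: "\<And>c. card {e \<in> E. \<alpha> e = c} \<le> h"
  shows "h * N * (N + 1) \<le> 2 * color_sum E \<alpha>"
proof -
  have le: "card {e \<in> E. \<alpha> e \<le> t} \<le> h * t" for t
  proof (induction t)
    case 0
    have "{e \<in> E. \<alpha> e \<le> 0} = {}" using assms(3) by fastforce
    then show ?case by (simp only: card.empty)
  next
    case (Suc t)
    have "{e \<in> E. \<alpha> e \<le> Suc t} = {e \<in> E. \<alpha> e \<le> t} \<union> {e \<in> E. \<alpha> e = Suc t}" by auto
    then have "card {e \<in> E. \<alpha> e \<le> Suc t} \<le> card {e \<in> E. \<alpha> e \<le> t} + card {e \<in> E. \<alpha> e = Suc t}"
      by (simp only: card_Un_le)
    also have "\<dots> \<le> h * t + h" using Suc class_le by (intro add_mono)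
    finally show ?case by simp
  qed
  have "h * (N - t) \<le> card {e \<in> E. t < \<alpha> e}" for t
  proof -
    have "card E = card {e \<in> E. \<alpha> e \<le> t} + card {e \<in> E. t < \<alpha> e}"
      using \<open>finite E\<close> by (subst card_Un_disjoint[symmetric]) (auto intro: arg_cong[of _ _ card])
    with le[of t] assms(2) show ?thesis by (simp add: diff_mult_distrib2)
  qed
  \<comment> \<open>Layer counting: on the right an edge \<open>e\<close> is counted once for every
    \<open>t < N\<close> with \<open>t < \<alpha> e\<close>, so at most \<open>\<alpha> e\<close>
    times.\<close>
  then have "(\<Sum>t<N. h * (N - t)) \<le> (\<Sum>t<N. card {e \<in> E. t < \<alpha> e})"
    by (intro sum_mono)
  also have "\<dots> = (\<Sum>t<N. \<Sum>e\<in>E. of_bool (t < \<alpha> e))"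
    using \<open>finite E\<close> by (intro sum.cong) (auto simp: Int_def)
  also have "\<dots> = (\<Sum>e\<in>E. \<Sum>t<N. of_bool (t < \<alpha> e))" by (rule sum.swap)
  also have "\<dots> = (\<Sum>e\<in>E. card ({..<N} \<inter> {t. t < \<alpha> e}))"
    by (intro sum.cong) auto
  also have "\<dots> \<le> (\<Sum>e\<in>E. card {..<\<alpha> e})"
    by (intro sum_mono card_mono) auto
  finally have "(\<Sum>t<N. h * (N - t)) \<le> color_sum E \<alpha>"
    by (simp add: color_sum_def)
  moreover have "2 * (\<Sum>t<M. h * (M - t)) = h * M * (M + 1)" for M
    by (induction M) (simp_all add: sum.lessThan_Suc_shift algebra_simps del: sum.lessThan_Suc)
  ultimately show ?thesis by (metis mult_le_mono2)
qed

text \<open>The reversed coloring \<open>N + 1 - \<alpha>\<close> has the same color classes.\<close>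

lemma color_sum_upper_bound:
  assumes "finite E" "card E = h * N" "\<And>e. e \<in> E \<Longrightarrow> \<alpha> e \<in> {1..N}"
    and class_le: "\<And>c. card {e \<in> E. \<alpha> e = c} \<le> h"
  shows "2 * color_sum E \<alpha> \<le> h * N * (N + 1)"
proof -
  let ?\<beta> = "\<lambda>e. N + 1 - \<alpha> e"
  have "h * N * (N + 1) \<le> 2 * color_sum E ?\<beta>"
  proof (rule color_sum_lower_bound)
    show "1 \<le> ?\<beta> e" if "e \<in> E" for e
      using assms(3)[OF that] by auto
    show "card {e \<in> E. ?\<beta> e = c} \<le> h" for c
    proof -
      have "{e \<in> E. ?\<beta> e = c} \<subseteq> {e \<in> E. \<alpha> e = N + 1 - c}"
      proof clarify
        fix e assume "e \<in> E"
        with assms(3)[of e] show "\<alpha> e = N + 1 - ?\<beta> e" by simp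
      qed
      then have "card {e \<in> E. ?\<beta> e = c} \<le> card {e \<in> E. \<alpha> e = N + 1 - c}"
        using assms(1) by (intro card_mono) auto
      with class_le show ?thesis by (rule le_trans[rotated])
    qed
  qed (use assms in auto)
  moreover have "color_sum E \<alpha> + color_sum E ?\<beta> = card E * (N + 1)"
  proof -
    have "(\<Sum>e\<in>E. \<alpha> e + ?\<beta> e) = (\<Sum>e\<in>E. N + 1)"
      using assms(3) by (intro sum.cong) (auto simp: Suc_le_eq le_Suc_eq)
    then show ?thesis by (simp add: color_sum_def sum.distrib)
  qed
  ultimately show ?thesis using assms(2) by (simp add: algebra_simps)
qed

section \<open>Round-robin coloring, color classes and edge count of complete graphs\<close>

lemma nsets2_other:
  assumes "e \<in> [V]\<^bsup>2\<^esup>" "x \<in> e"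
  shows "\<exists>y. e = {x, y} \<and> x \<in> V \<and> y \<in> V \<and> x \<noteq> y"
proof -
  from assms(1) obtain a b where "e = {a, b}" "a \<in> V" "b \<in> V" "a \<noteq> b" by (rule nsets2_E)
  with assms(2) show ?thesis by (cases "x = a") auto
qed

text \<open>The round-robin tournament: on \<open>{0..<m}\<close> color \<open>{x, y}\<close> by \<open>x + y\<close> modulo the odd
  number \<open>m\<close>; the color missing at \<open>x\<close> is \<open>2 * x\<close>, which goes to the edge \<open>{x, m}\<close>.\<close>

lemma round_robin:
  fixes m :: nat
  assumes "odd m"
  obtains \<gamma> :: "nat set \<Rightarrow> nat"
  where "\<And>e. \<gamma> e < m"
    "\<And>e f. \<lbrakk>e \<in> [{..m}]\<^bsup>2\<^esup>; f \<in> [{..m}]\<^bsup>2\<^esup>; e \<noteq> f; e \<inter> f \<noteq> {}\<rbrakk> \<Longrightarrow> \<gamma> e \<noteq> \<gamma> f"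
proof -
  define s where "s e = (if m \<in> e then 2 * \<Sum>(e - {m}) else \<Sum>e)" for e
  have s: "s {x, y} = (if x = m then y + y else if y = m then x + x else x + y)" if "x \<noteq> y" for x y
    using that by (auto simp: s_def insert_Diff_if)
  \<comment> \<open>Oddness of \<open>m\<close> enters here: \<open>2\<close> is invertible modulo
    \<open>m\<close>, so the edges at the vertex \<open>m\<close> get distinct colors.\<close>
  have double: "x = y" if "[x + x = y + y] (mod m)" "x < m" "y < m" for x y
  proof -
    have "coprime 2 m" using assms by simp
    moreover have "[2 * x = 2 * y] (mod m)" using that(1) by (simp add: mult_2)
    ultimately have "[x = y] (mod m)" by (simp add: cong_mult_lcancel_nat)
    with that show ?thesis by (simp add: cong_def)
  qed
  have cancel: "y = z" if "[x + y = x + z] (mod m)" "y < m" "z < m" for x y z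
    using that by (simp add: cong_add_lcancel_nat) (simp add: cong_def)
  have star: "\<not> [s {x, y} = s {x, z}] (mod m)"
    if neq: "x \<le> m" "y \<le> m" "z \<le> m" "x \<noteq> y" "x \<noteq> z" "y \<noteq> z" for x y z
  proof
    assume cong: "[s {x, y} = s {x, z}] (mod m)"
    \<comment> \<open>\<open>x\<close> is the common endpoint. If one edge goes to \<open>m\<close>,
      its value \<open>x + x\<close> is compared with the sum of \<open>x\<close> and another
      vertex, and cancelling \<open>x\<close> applies as in the ordinary case.\<close>
    consider "x = m" | "y = m" | "z = m" | "x < m" "y < m" "z < m"
      using neq by linarith
    then show False
    proof cases
      case 1
      with cong neq double[of y z] show False by (simp add: s)
    next
      case 2
      with cong neq cancel[of x x z] show False by (simp add: s)
    next
      case 3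
      with cong neq cancel[of x y x] show False by (simp add: s)
    next
      case 4
      with cong neq cancel[of x y z] show False by (simp add: s)
    qed
  qed
  show thesis
  proof (rule that[of "\<lambda>e. s e mod m"])
    show "s e mod m < m" for e using odd_pos[OF assms] by simp
    fix e f assume ef: "e \<in> [{..m}]\<^bsup>2\<^esup>" "f \<in> [{..m}]\<^bsup>2\<^esup>" "e \<noteq> f" "e \<inter> f \<noteq> {}"
    then obtain x where x: "x \<in> e" "x \<in> f" by blast
    obtain y where y: "e = {x, y}" "y \<le> m" "x \<le> m" "x \<noteq> y"
      using nsets2_other[OF ef(1) x(1)] by auto
    obtain z where z: "f = {x, z}" "z \<le> m" "x \<noteq> z"
      using nsets2_other[OF ef(2) x(2)] by auto
    have "y \<noteq> z" using ef(3) y(1) z(1) by blast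
    with star[of x y z] y z show "s e mod m \<noteq> s f mod m" by (simp add: cong_def)
  qed
qed

text \<open>\<open>C\<close> is embedded into the \<open>m + 1\<close> points \<open>{..m}\<close>
  with \<open>m\<close> odd: onto them if \<open>card C\<close> is even, missing one point if it is
  odd. The colors are shifted by one since the round-robin colors start at \<open>0\<close>.\<close>

lemma complete_graph_coloring:
  assumes "finite C"
  obtains \<beta> where "proper_edge_coloring ([C]\<^bsup>2\<^esup>) \<beta>"
    "\<And>e. e \<in> [C]\<^bsup>2\<^esup> \<Longrightarrow> \<beta> e \<in> {1..if even (card C) then card C - 1 else card C}"
proof (cases "C = {}")
  case True
  then have "[C]\<^bsup>2\<^esup> = {}" by (auto elim: nsets2_E)
  then show thesis using that by (simp add: proper_edge_coloring_def)
next
  case False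
  define m where "m = (if even (card C) then card C - 1 else card C)"
  have "card C > 0" using False assms by (simp add: card_gt_0_iff)
  then have m: "odd m" "card C \<le> Suc m" by (auto simp: m_def)
  obtain \<gamma> where \<gamma>: "\<And>e. \<gamma> e < m"
    "\<And>e f. \<lbrakk>e \<in> [{..m}]\<^bsup>2\<^esup>; f \<in> [{..m}]\<^bsup>2\<^esup>; e \<noteq> f; e \<inter> f \<noteq> {}\<rbrakk> \<Longrightarrow> \<gamma> e \<noteq> \<gamma> f"
    by (rule round_robin[OF m(1)]) (rule that)
  obtain g where g: "inj_on g C" "g ` C \<subseteq> {..m}"
    using card_le_inj[of C "{..m}"] assms m(2) by auto
  have g2: "g ` e \<in> [{..m}]\<^bsup>2\<^esup>" if "e \<in> [C]\<^bsup>2\<^esup>" for e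
  proof -
    from that obtain x y where e: "e = {x, y}" "x \<in> C" "y \<in> C" "x \<noteq> y" by (rule nsets2_E)
    then have "g x \<noteq> g y" using g(1) by (simp add: inj_on_eq_iff)
    with e g(2) show ?thesis by (simp add: image_subset_iff)
  qed
  let ?\<beta> = "\<lambda>e. Suc (\<gamma> (g ` e))"
  show thesis
  proof (rule that[of ?\<beta>])
    show "proper_edge_coloring ([C]\<^bsup>2\<^esup>) ?\<beta>"
      unfolding proper_edge_coloring_def
    proof (intro conjI ballI impI)
      fix e f assume ef: "e \<in> [C]\<^bsup>2\<^esup>" "f \<in> [C]\<^bsup>2\<^esup>" "e \<noteq> f \<and> e \<inter> f \<noteq> {}"
      then have "e \<subseteq> C" "f \<subseteq> C" by (auto simp: nsets_def)
      then have "g ` e \<noteq> g ` f" using inj_on_image_eq_iff[OF g(1)] ef(3) by blast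
      moreover have "g ` e \<inter> g ` f \<noteq> {}" using ef(3) by blast
      ultimately show "?\<beta> e \<noteq> ?\<beta> f"
        using \<gamma>(2)[OF g2[OF ef(1)] g2[OF ef(2)]] by simp
    qed simp
    show "?\<beta> e \<in> {1..if even (card C) then card C - 1 else card C}" for e
      using \<gamma>(1)[of "g ` e"] unfolding m_def[symmetric] by (simp add: Suc_le_eq)
  qed
qed

text \<open>A color class is a matching, so its edges cover twice as many vertices as there are
  edges.\<close>

lemma card_color_class_complete:
  assumes "finite C" "proper_edge_coloring ([C]\<^bsup>2\<^esup>) \<alpha>"
  shows "card {e \<in> [C]\<^bsup>2\<^esup>. \<alpha> e = c} \<le> card C div 2"
proof -
  let ?K = "{e \<in> [C]\<^bsup>2\<^esup>. \<alpha> e = c}"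
  have "card (\<Union>?K) = (\<Sum>e\<in>?K. card e)"
  proof (rule card_Union_disjoint)
    show "pairwise disjnt ?K"
      using assms(2) by (auto simp: pairwise_def disjnt_def proper_edge_coloring_def)
  qed (auto simp: nsets_def)
  also have "\<dots> = 2 * card ?K" by (simp add: nsets_def)
  finally have "2 * card ?K = card (\<Union>?K)" ..
  also have "\<dots> \<le> card C"
    using assms(1) by (intro card_mono) (auto simp: nsets_def)
  finally show ?thesis by linarith
qed

text \<open>The binomial coefficient is factored as largest matching size times number of
  round-robin colors, the shape \<open>h * N\<close> that the color sum bounds require.\<close>

lemma card_edges_complete:
  assumes "finite C"
  shows "card ([C]\<^bsup>2\<^esup>) = card C div 2 * (if even (card C) then card C - 1 else card C)"
proof -
  have "card ([C]\<^bsup>2\<^esup>) = card {S. S \<subseteq> C \<and> card S = 2}"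
    using assms by (intro arg_cong[of _ _ card]) (auto simp: nsets_def intro: finite_subset)
  also have "\<dots> = card C * (card C - 1) div 2"
    using n_subsets[OF assms] by (simp add: choose_two)
  also have "\<dots> = card C div 2 * (if even (card C) then card C - 1 else card C)"
  proof (cases "even (card C)")
    case True
    then obtain k where "card C = 2 * k" by (rule evenE)
    then show ?thesis by simp
  next
    case False
    then obtain k where "card C = 2 * k + 1" by (rule oddE)
    then show ?thesis by simp
  qed
  finally show ?thesis .
qed

section \<open>Split graphs\<close>

lemma degree_eq_card_neighbours:
  assumes "E \<subseteq> [V]\<^bsup>2\<^esup>"
  shows "degree E x = card {y. {x, y} \<in> E}"
proof -
  have "{e \<in> E. x \<in> e} = (\<lambda>y. {x, y}) ` {y. {x, y} \<in> E}"
  proof (intro set_eqI iffI)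
    fix e assume e: "e \<in> {e \<in> E. x \<in> e}"
    with assms have "e \<in> [V]\<^bsup>2\<^esup>" "x \<in> e" by auto
    then obtain y where "e = {x, y}" using nsets2_other by metis
    with e show "e \<in> (\<lambda>y. {x, y}) ` {y. {x, y} \<in> E}" by auto
  qed auto
  moreover have "inj_on (\<lambda>y. {x, y}) {y. {x, y} \<in> E}"
    by (auto simp: inj_on_def doubleton_eq_iff)
  ultimately show ?thesis by (simp add: degree_def card_image)
qed

text \<open>Ordered pairs with the clique end first, so that relation images give the neighbourhoods
  used in the bipartite lemmas.\<close>

definition cross :: "'a set \<Rightarrow> 'a set \<Rightarrow> 'a set set \<Rightarrow> ('a \<times> 'a) set" where
  "cross C I E = {(u, v) \<in> C \<times> I. {u, v} \<in> E}"

lemma cross_subset: "cross C I E \<subseteq> C \<times> I"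
  by (auto simp: cross_def)

lemma split_graph_edges:
  assumes "split_graph C I E"
  shows "E = [C]\<^bsup>2\<^esup> \<union> (\<lambda>(u, v). {u, v}) ` cross C I E"
proof
  have *: "E \<subseteq> [C \<union> I]\<^bsup>2\<^esup>" "clique C E" "indep I E"
    using assms by (auto simp: split_graph_def fin_graph_def)
  show "E \<subseteq> [C]\<^bsup>2\<^esup> \<union> (\<lambda>(u, v). {u, v}) ` cross C I E"
  proof
    fix e assume e: "e \<in> E"
    with *(1) have "e \<in> [C \<union> I]\<^bsup>2\<^esup>" by blast
    then obtain x y where xy: "e = {x, y}" "x \<in> C \<union> I" "y \<in> C \<union> I" "x \<noteq> y" by (rule nsets2_E)
    have "\<not> (x \<in> I \<and> y \<in> I)" using *(3) e xy by (auto simp: indep_def)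
    then consider "x \<in> C" "y \<in> C" | "x \<in> C" "y \<in> I" | "y \<in> C" "x \<in> I"
      using xy by blast
    then show "e \<in> [C]\<^bsup>2\<^esup> \<union> (\<lambda>(u, v). {u, v}) ` cross C I E"
    proof cases
      case 1
      with xy show ?thesis by simp
    next
      case 2
      with xy e have "(x, y) \<in> cross C I E" by (simp add: cross_def)
      then have "(\<lambda>(u, v). {u, v}) (x, y) \<in> (\<lambda>(u, v). {u, v}) ` cross C I E" by (rule imageI)
      with xy(1) show ?thesis by simp
    next
      case 3
      with xy e have "(y, x) \<in> cross C I E" by (simp add: cross_def insert_commute)
      then have "(\<lambda>(u, v). {u, v}) (y, x) \<in> (\<lambda>(u, v). {u, v}) ` cross C I E" by (rule imageI)
      with xy(1) show ?thesis by (simp add: insert_commute)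
    qed
  qed
  show "[C]\<^bsup>2\<^esup> \<union> (\<lambda>(u, v). {u, v}) ` cross C I E \<subseteq> E"
  proof (rule Un_least)
    show "[C]\<^bsup>2\<^esup> \<subseteq> E"
    proof
      fix e assume "e \<in> [C]\<^bsup>2\<^esup>"
      then obtain x y where "e = {x, y}" "x \<in> C" "y \<in> C" "x \<noteq> y" by (rule nsets2_E)
      with *(2) show "e \<in> E" by (simp add: clique_def)
    qed
    show "(\<lambda>(u, v). {u, v}) ` cross C I E \<subseteq> E" by (auto simp: cross_def)
  qed
qed

lemma degree_independent_vertex:
  assumes "split_graph C I E" "v \<in> I"
  shows "degree E v = card ((cross C I E)\<inverse> `` {v})"
proof -
  have *: "E \<subseteq> [C \<union> I]\<^bsup>2\<^esup>" "indep I E"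
    using assms by (auto simp: split_graph_def fin_graph_def)
  have "y \<in> C" if "{v, y} \<in> E" for y
  proof -
    have "{v, y} \<in> [C \<union> I]\<^bsup>2\<^esup>" using *(1) that by (rule subsetD)
    then show ?thesis using *(2) assms(2) that by (auto simp: indep_def)
  qed
  then have "{y. {v, y} \<in> E} = (cross C I E)\<inverse> `` {v}"
    using assms(2) by (auto simp: cross_def insert_commute)
  with degree_eq_card_neighbours[OF *(1)] show ?thesis by simp
qed

text \<open>Together with \<open>degree_independent_vertex\<close> this turns the degree hypothesis
  on \<open>E\<close> into the degree condition on \<open>cross C I E\<close>.\<close>

lemma degree_clique_vertex:
  assumes "split_graph C I E" "u \<in> C"
  shows "degree E u = (card C - 1) + card (cross C I E `` {u})"
proof -
  have *: "E \<subseteq> [C \<union> I]\<^bsup>2\<^esup>" "clique C E" "C \<inter> I = {}" "finite C" "finite I"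
    using assms by (auto simp: split_graph_def fin_graph_def)
  have "y \<in> C - {u} \<or> y \<in> I" if "{u, y} \<in> E" for y
  proof -
    have "{u, y} \<in> [C \<union> I]\<^bsup>2\<^esup>" using *(1) that by (rule subsetD)
    then show ?thesis by auto
  qed
  then have "{y. {u, y} \<in> E} = (C - {u}) \<union> cross C I E `` {u}"
    using assms(2) *(2) by (auto simp: cross_def clique_def)
  moreover have "(C - {u}) \<inter> cross C I E `` {u} = {}" using *(3) by (auto simp: cross_def)
  moreover have "finite (cross C I E `` {u})"
    using *(5) cross_subset[of C I E] by (auto intro: finite_subset[of _ I])
  ultimately have "card {y. {u, y} \<in> E} = card (C - {u}) + card (cross C I E `` {u})"
    using *(4) by (simp add: card_Un_disjoint)
  with degree_eq_card_neighbours[OF *(1)] assms(2) show ?thesis by simp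
qed

section \<open>Combining colorings of the clique and of the cross edges\<close>

text \<open>The shifts \<open>s\<close> and \<open>t\<close> serve both bounds, each of which sets
  one of them to \<open>0\<close>. Doubling keeps the triangular sums over \<open>I\<close> free of
  division.\<close>

lemma split_shifted_coloring:
  fixes C I :: "'a set" and f :: "'a \<times> 'a \<Rightarrow> nat"
  assumes G: "split_graph C I E"
    and \<beta>: "proper_edge_coloring ([C]\<^bsup>2\<^esup>) \<beta>"
    and fC: "\<And>u. inj_on (\<lambda>v. f (u, v)) (cross C I E `` {u})"
    and fI: "\<And>v. bij_betw (\<lambda>u. f (u, v)) ((cross C I E)\<inverse> `` {v})
               {1..card ((cross C I E)\<inverse> `` {v})}"
    and sep: "\<And>e p. e \<in> [C]\<^bsup>2\<^esup> \<Longrightarrow> p \<in> cross C I E \<Longrightarrow> \<beta> e + s \<noteq> f p + t"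
  shows "2 * edge_chromatic_sum E \<le> 2 * color_sum ([C]\<^bsup>2\<^esup>) \<beta> + 2 * s * card ([C]\<^bsup>2\<^esup>)
           + (\<Sum>v\<in>I. degree E v * (degree E v + 1 + 2 * t))"
proof -
  define H where "H = cross C I E"
  define q :: "'a \<times> 'a \<Rightarrow> 'a set" where "q = (\<lambda>(u, v). {u, v})"
  have fin: "finite C" "finite I" and disj: "C \<inter> I = {}"
    using G by (auto simp: split_graph_def fin_graph_def)
  have H: "H \<subseteq> C \<times> I" unfolding H_def by (rule cross_subset)
  then have finH: "finite H" using fin by (meson finite_SigmaI finite_subset)
  have E: "E = [C]\<^bsup>2\<^esup> \<union> q ` H"
    unfolding H_def q_def by (rule split_graph_edges[OF G])
  have q_inj: "inj_on q H"
  proof (rule inj_onI)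
    fix a b assume "a \<in> H" "b \<in> H" "q a = q b"
    moreover obtain u v x y where "a = (u, v)" "b = (x, y)" by (metis prod.exhaust)
    ultimately show "a = b" using H disj by (auto simp: q_def doubleton_eq_iff)
  qed
  have not_sub: "\<not> q p \<subseteq> C" if "p \<in> H" for p
    using that H disj by (cases p) (auto simp: q_def)
  have sub: "e \<subseteq> C" if "e \<in> [C]\<^bsup>2\<^esup>" for e
    using that by (simp add: nsets_def)
  \<comment> \<open>Clique edges are recognised by \<open>e \<subseteq> C\<close>; any other edge is
    decoded to its ordered pair, which is unique because \<open>C\<close> and \<open>I\<close> are
    disjoint.\<close>
  define \<alpha> where "\<alpha> e = (if e \<subseteq> C then \<beta> e + s else f (inv_into H q e) + t)" for e
  have \<alpha>C: "\<alpha> e = \<beta> e + s" if "e \<in> [C]\<^bsup>2\<^esup>" for e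
    using sub[OF that] by (simp add: \<alpha>_def)
  have \<alpha>H: "\<alpha> (q p) = f p + t" if "p \<in> H" for p
    using not_sub[OF that] inv_into_f_f[OF q_inj that] by (simp add: \<alpha>_def)
  have f_pos: "1 \<le> f p" if "p \<in> H" for p
  proof -
    obtain u v where p: "p = (u, v)" by (cases p)
    with that have "u \<in> (cross C I E)\<inverse> `` {v}" by (simp add: H_def)
    from bij_betw_apply[OF fI this] show ?thesis by (simp add: p)
  qed
  have "proper_edge_coloring E \<alpha>"
    unfolding proper_edge_coloring_def
  proof (intro conjI ballI impI)
    fix e assume "e \<in> E"
    then consider "e \<in> [C]\<^bsup>2\<^esup>" | p where "p \<in> H" "e = q p" unfolding E by blast
    then show "1 \<le> \<alpha> e"
    proof cases
      case 1
      then have "1 \<le> \<beta> e" using \<beta> by (simp add: proper_edge_coloring_def)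
      with \<alpha>C[OF 1] show ?thesis by simp
    next
      case 2
      with \<alpha>H[OF 2(1)] f_pos[OF 2(1)] show ?thesis by simp
    qed
  next
    fix e g assume e: "e \<in> E" and g: "g \<in> E" and eg: "e \<noteq> g \<and> e \<inter> g \<noteq> {}"
    from e consider "e \<in> [C]\<^bsup>2\<^esup>" | p where "p \<in> H" "e = q p" unfolding E by blast
    note e_cases = this
    from g consider "g \<in> [C]\<^bsup>2\<^esup>" | r where "r \<in> H" "g = q r" unfolding E by blast
    note g_cases = this
    from e_cases show "\<alpha> e \<noteq> \<alpha> g"
    proof cases
      case e1: 1
      from g_cases show ?thesis
      proof cases
        case 1
        then have "\<beta> e \<noteq> \<beta> g" using \<beta> e1 eg by (simp add: proper_edge_coloring_def)
        then show ?thesis using \<alpha>C[OF e1] \<alpha>C[OF 1] by simp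
      next
        case 2
        then show ?thesis using \<alpha>C[OF e1] \<alpha>H[OF 2(1)] sep[OF e1, of r] by (simp add: H_def)
      qed
    next
      case e2: 2
      from g_cases show ?thesis
      proof cases
        case 1
        then show ?thesis using \<alpha>C[OF 1] \<alpha>H[OF e2(1)] e2(2) sep[OF 1, of p] e2(1)
          by (simp add: H_def)
      next
        case 2
        obtain u v x y where p: "p = (u, v)" and r: "r = (x, y)" by (metis prod.exhaust)
        have mem: "u \<in> C" "v \<in> I" "x \<in> C" "y \<in> I" using e2(1) 2(1) H p r by auto
        \<comment> \<open>Cross edges that meet must share their clique ends or their independent
          ends.\<close>
        then have "u \<noteq> y" "v \<noteq> x" using disj by auto
        with eg e2(2) 2(2) p r have "u = x \<or> v = y" "p \<noteq> r" by (auto simp: q_def)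
        moreover have "f p \<noteq> f r" if "u = x" "v \<noteq> y"
        proof
          assume "f p = f r"
          with that(1) have "f (u, v) = f (u, y)" by (simp add: p r)
          moreover have "v \<in> cross C I E `` {u}" "y \<in> cross C I E `` {u}"
            using e2(1) 2(1) p r that(1) by (simp_all add: H_def)
          ultimately have "v = y" by (rule inj_onD[OF fC])
          with that(2) show False by simp
        qed
        moreover have "f p \<noteq> f r" if "v = y" "u \<noteq> x"
        proof
          assume "f p = f r"
          with that(1) have "f (u, v) = f (x, v)" by (simp add: p r)
          moreover have "u \<in> (cross C I E)\<inverse> `` {v}" "x \<in> (cross C I E)\<inverse> `` {v}"
            using e2(1) 2(1) p r that(1) by (simp_all add: H_def)
          ultimately have "u = x" by (rule inj_onD[OF bij_betw_imp_inj_on[OF fI]])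
          with that(2) show False by simp
        qed
        ultimately have "f p \<noteq> f r" using p r by blast
        then show ?thesis using \<alpha>H[OF e2(1)] \<alpha>H[OF 2(1)] e2(2) 2(2) by simp
      qed
    qed
  qed
  then have "edge_chromatic_sum E \<le> color_sum E \<alpha>"
    unfolding edge_chromatic_sum_def by (intro Least_le) blast
  also have "color_sum E \<alpha> = (\<Sum>e\<in>[C]\<^bsup>2\<^esup>. \<alpha> e) + (\<Sum>e\<in>q ` H. \<alpha> e)"
    unfolding color_sum_def E
  proof (rule sum.union_disjoint)
    show "[C]\<^bsup>2\<^esup> \<inter> q ` H = {}" using sub not_sub by blast
  qed (use fin finH in \<open>simp_all add: finite_imp_finite_nsets\<close>)
  also have "(\<Sum>e\<in>[C]\<^bsup>2\<^esup>. \<alpha> e) = color_sum ([C]\<^bsup>2\<^esup>) \<beta> + s * card ([C]\<^bsup>2\<^esup>)"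
    using \<alpha>C by (simp add: color_sum_def sum.distrib)
  also have "(\<Sum>e\<in>q ` H. \<alpha> e) = (\<Sum>p\<in>H. f p + t)"
    using \<alpha>H by (simp add: sum.reindex[OF q_inj])
  \<comment> \<open>Cross edges are grouped by their end in \<open>I\<close>, where the unshifted
    colors are exactly \<open>1\<close> to the degree.\<close>
  also have "\<dots> = (\<Sum>v\<in>I. \<Sum>p\<in>{p \<in> H. snd p = v}. f p + t)"
    using finH fin H by (intro sum.group[symmetric]) auto
  also have "\<dots> = (\<Sum>v\<in>I. \<Sum>{1..degree E v} + degree E v * t)"
  proof (rule sum.cong)
    fix v assume v: "v \<in> I"
    have deg: "degree E v = card (H\<inverse> `` {v})"
      unfolding H_def by (rule degree_independent_vertex[OF G v])
    have "{p \<in> H. snd p = v} = (\<lambda>u. (u, v)) ` (H\<inverse> `` {v})" by force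
    then have "(\<Sum>p\<in>{p \<in> H. snd p = v}. f p + t) = (\<Sum>u\<in>H\<inverse> `` {v}. f (u, v) + t)"
      by (simp add: sum.reindex inj_on_def)
    also have "\<dots> = (\<Sum>u\<in>H\<inverse> `` {v}. f (u, v)) + degree E v * t"
      by (simp add: sum.distrib deg)
    also have "(\<Sum>u\<in>H\<inverse> `` {v}. f (u, v)) = \<Sum>{1..degree E v}"
      unfolding deg H_def by (rule sum.reindex_bij_betw[OF fI])
    finally show "(\<Sum>p\<in>{p \<in> H. snd p = v}. f p + t) = \<Sum>{1..degree E v} + degree E v * t" .
  qed simp
  finally have "2 * edge_chromatic_sum E \<le> 2 * color_sum ([C]\<^bsup>2\<^esup>) \<beta> + 2 * s * card ([C]\<^bsup>2\<^esup>)
      + 2 * (\<Sum>v\<in>I. \<Sum>{1..degree E v} + degree E v * t)"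
    by (simp add: algebra_simps)
  also have "2 * (\<Sum>v\<in>I. \<Sum>{1..degree E v} + degree E v * t)
      = (\<Sum>v\<in>I. degree E v * (degree E v + 1 + 2 * t))"
  proof -
    have gauss: "2 * \<Sum>{1..d} = d * (d + 1)" for d :: nat
      by (induction d) simp_all
    show ?thesis
      unfolding sum_distrib_left
    proof (rule sum.cong)
      show "2 * (\<Sum>{1..degree E v} + degree E v * t) = degree E v * (degree E v + 1 + 2 * t)" for v
        using gauss[of "degree E v"] by (simp add: distrib_left)
    qed simp
  qed
  finally show ?thesis .
qed

text \<open>Write \<open>h N\<close> for the number of edges of the clique, where \<open>h = n div 2\<close> bounds the size of
  a matching and \<open>N\<close> is the number of colors of the round-robin coloring, which therefore
  attains the edge-chromatic sum \<open>h N (N + 1) / 2\<close> of \<open>K\<^sub>n\<close>.\<close>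

lemma split_graph_bounds:
  fixes C I :: "'a set"
  assumes G: "split_graph C I E"
    and deg: "\<And>u v. u \<in> C \<Longrightarrow> v \<in> I \<Longrightarrow> {u, v} \<in> E \<Longrightarrow>
           int (degree E u) - int (degree E v) \<le> int (card C) - 1"
  defines "h \<equiv> card C div 2" and "N \<equiv> if even (card C) then card C - 1 else card C"
  shows "2 * edge_chromatic_sum E \<le>
           h * N * (N + 1 + 2 * max_degree_on E I) + (\<Sum>v\<in>I. degree E v * (degree E v + 1))"
    and "2 * edge_chromatic_sum E \<le>
           2 * edge_chromatic_sum (complete_graph_edges (card C))
             + (\<Sum>v\<in>I. degree E v * (degree E v + 1 + 2 * N))"
proof -
  let ?H = "cross C I E" and ?\<Delta> = "max_degree_on E I"
  have fin: "finite C" "finite I" and disj: "C \<inter> I = {}"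
    using G by (auto simp: split_graph_def fin_graph_def)
  have degI: "card (?H\<inverse> `` {v}) \<le> ?\<Delta>" if "v \<in> I" for v
    using fin that unfolding max_degree_on_def degree_independent_vertex[OF G that, symmetric]
    by (intro Max_ge) auto
  have "\<exists>f :: 'a \<times> 'a \<Rightarrow> nat. (\<forall>a. inj_on (\<lambda>b. f (a, b)) (?H `` {a})) \<and>
    (\<forall>b. bij_betw (\<lambda>a. f (a, b)) (?H\<inverse> `` {b}) {1..card (?H\<inverse> `` {b})})"
  proof (rule bipartite_interval_coloring[OF fin disj cross_subset _ degI])
    fix u v assume "(u, v) \<in> ?H"
    then have uv: "u \<in> C" "v \<in> I" "{u, v} \<in> E" by (auto simp: cross_def)
    \<comment> \<open>Makes the truncated \<open>card C - 1\<close> in the degree of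
      \<open>u\<close> agree with the integer difference in the hypothesis.\<close>
    have "card C > 0" using uv(1) fin(1) by (auto simp: card_gt_0_iff)
    with deg[OF uv] show "card (?H `` {u}) \<le> card (?H\<inverse> `` {v})"
      unfolding degree_clique_vertex[OF G uv(1)] degree_independent_vertex[OF G uv(2)] by simp
  qed
  then obtain f :: "'a \<times> 'a \<Rightarrow> nat"
    where fC: "\<And>u. inj_on (\<lambda>v. f (u, v)) (?H `` {u})"
      and fI: "\<And>v. bij_betw (\<lambda>u. f (u, v)) (?H\<inverse> `` {v}) {1..card (?H\<inverse> `` {v})}"
    by blast
  have f_range: "1 \<le> f p \<and> f p \<le> ?\<Delta>" if "p \<in> ?H" for p
  proof -
    obtain u v where p: "p = (u, v)" by (cases p)
    with that have "u \<in> ?H\<inverse> `` {v}" "v \<in> I" by (simp_all add: cross_def)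
    from bij_betw_apply[OF fI this(1)] degI[OF this(2)] show ?thesis by (simp add: p)
  qed
  obtain \<beta> where \<beta>: "proper_edge_coloring ([C]\<^bsup>2\<^esup>) \<beta>"
    and \<beta>_range: "\<And>e. e \<in> [C]\<^bsup>2\<^esup> \<Longrightarrow> \<beta> e \<in> {1..N}"
    using complete_graph_coloring[OF fin(1)] unfolding N_def by metis
  have card_K: "card ([C]\<^bsup>2\<^esup>) = h * N"
    unfolding h_def N_def by (rule card_edges_complete[OF fin(1)])
  have sum_\<beta>: "2 * color_sum ([C]\<^bsup>2\<^esup>) \<beta> \<le> h * N * (N + 1)"
    using fin(1) card_K \<beta>_range card_color_class_complete[OF fin(1) \<beta>] unfolding h_def[symmetric]
    by (intro color_sum_upper_bound) (simp_all add: finite_imp_finite_nsets)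
  \<comment> \<open>First bound: the cross edges use only colors up to \<open>?\<Delta>\<close>, and
    the clique is moved above them.\<close>
  have "2 * edge_chromatic_sum E \<le> 2 * color_sum ([C]\<^bsup>2\<^esup>) \<beta> + 2 * ?\<Delta> * card ([C]\<^bsup>2\<^esup>)
      + (\<Sum>v\<in>I. degree E v * (degree E v + 1 + 2 * 0))"
  proof (rule split_shifted_coloring[OF G \<beta> fC fI])
    show "\<beta> e + ?\<Delta> \<noteq> f p + 0" if "e \<in> [C]\<^bsup>2\<^esup>" "p \<in> ?H" for e p
      using \<beta>_range[OF that(1)] f_range[OF that(2)] by simp
  qed
  with sum_\<beta> show "2 * edge_chromatic_sum E \<le>
      h * N * (N + 1 + 2 * ?\<Delta>) + (\<Sum>v\<in>I. degree E v * (degree E v + 1))"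
    unfolding card_K by (simp add: algebra_simps)
  have "h * N * (N + 1) \<le> 2 * edge_chromatic_sum (complete_graph_edges (card C))"
  proof -
    define n where "n = card C"
    let ?K = "complete_graph_edges n"
    have finK: "finite ?K" by (simp add: complete_graph_edges_def finite_imp_finite_nsets)
    obtain \<alpha> where \<alpha>: "proper_edge_coloring ?K \<alpha>" "color_sum ?K \<alpha> = edge_chromatic_sum ?K"
      using edge_chromatic_sum_attained[OF finK] by blast
    have "h * N * (N + 1) \<le> 2 * color_sum ?K \<alpha>"
    proof (rule color_sum_lower_bound[OF finK])
      show "card ?K = h * N"
        using card_edges_complete[of "{1..n}"] by (simp add: complete_graph_edges_def h_def N_def n_def)
      show "card {e \<in> ?K. \<alpha> e = c} \<le> h" for c
        using card_color_class_complete[of "{1..n}" \<alpha> c] \<alpha>(1)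
        by (simp add: complete_graph_edges_def h_def n_def)
      show "1 \<le> \<alpha> e" if "e \<in> ?K" for e
        using \<alpha>(1) that by (simp add: proper_edge_coloring_def)
    qed
    with \<alpha>(2) show ?thesis by (simp add: n_def)
  qed
  \<comment> \<open>Second bound: the clique keeps colors up to \<open>N\<close>, and the cross
    edges are moved above them.\<close>
  moreover have "2 * edge_chromatic_sum E \<le> 2 * color_sum ([C]\<^bsup>2\<^esup>) \<beta> + 2 * 0 * card ([C]\<^bsup>2\<^esup>)
      + (\<Sum>v\<in>I. degree E v * (degree E v + 1 + 2 * N))"
  proof (rule split_shifted_coloring[OF G \<beta> fC fI])
    show "\<beta> e + 0 \<noteq> f p + N" if "e \<in> [C]\<^bsup>2\<^esup>" "p \<in> ?H" for e p
      using \<beta>_range[OF that(1)] f_range[OF that(2)] by simp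
  qed
  ultimately show "2 * edge_chromatic_sum E \<le>
      2 * edge_chromatic_sum (complete_graph_edges (card C))
        + (\<Sum>v\<in>I. degree E v * (degree E v + 1 + 2 * N))"
    using sum_\<beta> by linarith
qed

theorem theorem14:
  fixes C I :: "'a set" and E :: "'a set set" and n :: nat
  assumes "split_graph C I E"
    and "card C = n"
    and "\<And>u v. u \<in> C \<Longrightarrow> v \<in> I \<Longrightarrow> {u, v} \<in> E \<Longrightarrow>
           int (degree E u) - int (degree E v) \<le> int n - 1"
  shows "(even n \<longrightarrow>
           real (edge_chromatic_sum E) \<le>
             min ((\<Sum>v\<in>I. real (degree E v) * (real (degree E v) + 1) / 2)
                    + (2 * real (max_degree_on E I) + real n) * real n * (real n - 1) / 4)
                 (real (edge_chromatic_sum (complete_graph_edges n))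
                    + (\<Sum>v\<in>I. real (degree E v) * (real (degree E v) + 2 * real n - 1) / 2)))
         \<and> (odd n \<longrightarrow>
           real (edge_chromatic_sum E) \<le>
             min ((\<Sum>v\<in>I. real (degree E v) * (real (degree E v) + 1) / 2)
                    + (2 * real (max_degree_on E I) + real n + 1) * real n * (real n - 1) / 4)
                 (real (edge_chromatic_sum (complete_graph_edges n))
                    + (\<Sum>v\<in>I. real (degree E v) * (real (degree E v) + 2 * real n + 1) / 2)))"
proof -
  let ?e = "edge_chromatic_sum E" and ?k = "edge_chromatic_sum (complete_graph_edges n)"
    and ?\<Delta> = "max_degree_on E I"
  define h N where "h = n div 2" and "N = (if even n then n - 1 else n)"
  note bounds = split_graph_bounds[OF assms(1), unfolded assms(2), folded h_def N_def, OF assms(3)]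
  have "real (2 * ?e) \<le> real (h * N * (N + 1 + 2 * ?\<Delta>) + (\<Sum>v\<in>I. degree E v * (degree E v + 1)))"
    using bounds(1) by (simp only: of_nat_le_iff)
  then have bound1: "real ?e \<le> (\<Sum>v\<in>I. real (degree E v) * (real (degree E v) + 1) / 2)
      + real h * real N * (real N + 1 + 2 * real ?\<Delta>) / 2"
    by (simp add: sum_divide_distrib[symmetric] field_simps)
  have "real (2 * ?e) \<le> real (2 * ?k + (\<Sum>v\<in>I. degree E v * (degree E v + 1 + 2 * N)))"
    using bounds(2) by (simp only: of_nat_le_iff)
  then have bound2: "real ?e \<le>
      real ?k + (\<Sum>v\<in>I. real (degree E v) * (real (degree E v) + 1 + 2 * real N) / 2)"
    by (simp add: sum_divide_distrib[symmetric] field_simps)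
  show ?thesis
  proof (cases "even n")
    case True
    then have h: "real h = real n / 2" by (auto simp: h_def elim: evenE)
    \<comment> \<open>For \<open>n = 0\<close> truncation gives \<open>N = 0\<close> instead of
      \<open>-1\<close>. That case is treated apart: both sides of \<open>K\<close> vanish, and in
      \<open>d\<close> all degrees in \<open>I\<close> are \<open>0\<close>.\<close>
    have N: "real N = real n - 1" if "n > 0"
      using that True by (simp add: N_def of_nat_diff)
    have K: "real h * real N * (real N + 1 + 2 * real ?\<Delta>) / 2
        = (2 * real ?\<Delta> + real n) * real n * (real n - 1) / 4"
      by (cases "n = 0") (simp_all add: h N field_simps)
    have d: "real (degree E v) * (real (degree E v) + 1 + 2 * real N)
        = real (degree E v) * (real (degree E v) + 2 * real n - 1)" if "v \<in> I" for v
    proof (cases "n = 0")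
      case True
      then have "C = {}" using assms(1,2) by (simp add: split_graph_def fin_graph_def)
      then have "degree E v = 0"
        using degree_independent_vertex[OF assms(1) that] by (simp add: cross_def)
      then show ?thesis by simp
    qed (simp add: N algebra_simps)
    have "(\<Sum>v\<in>I. real (degree E v) * (real (degree E v) + 1 + 2 * real N) / 2)
        = (\<Sum>v\<in>I. real (degree E v) * (real (degree E v) + 2 * real n - 1) / 2)"
      by (intro sum.cong refl) (simp only: d)
    with True bound1[unfolded K] bound2 show ?thesis by simp
  next
    case False
    then have h: "real h = (real n - 1) / 2" by (auto simp: h_def elim: oddE)
    have N: "N = n" using False by (simp add: N_def)
    have K: "real h * real N * (real N + 1 + 2 * real ?\<Delta>) / 2
        = (2 * real ?\<Delta> + real n + 1) * real n * (real n - 1) / 4"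
      by (simp add: h N field_simps)
    with False bound1[unfolded K] bound2 show ?thesis by (simp add: N add_ac)
  qed
qed

end
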